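(* For $n\ge 1$ let $R_n$ be the number of acyclic digraphs on $n$ labelled vertices and $O_n$ the number of acyclic digraphs on $n$ labelled vertices all of whose vertices have even out-degree. Let $F(x)=\sum_{n=0}^\infty \frac{x^n}{n!\,2^{\binom n2}}$, let $\alpha\approx-1.488$ be the zero of $F$ near $-1.488$, and put $$K=-\frac{1-F(2\alpha)}{\alpha F\left(\frac{\alpha}{2}\right)},\qquad C=-\frac{1}{\alpha F\left(\frac{\alpha}{2}\right)}.$$ Then, as $n\to\infty$, $$\frac{O_n}{R_n}\sim\frac{K}{C\,2^n},$$ where $\frac{K}{C}\approx 1.262$.
   Context: A (simple) digraph with $n$ labelled vertices is a pair $(V,E)$ with $V=\{v_1,\dots,v_n\}$ and $E\subseteq\{(u,v)\in V\times V: u\neq v\}$ (no loops, at most one edge from $u$ to $v$). It is acyclic if it contains no directed cycle, i.e. no closed directed walk $v_0,v_1,\dots,v_k=v_0$ with $k\ge 1$, $(v_i,v_{i+1})\in E$ for all $0\le i\le k-1$, and all the $v_i$ distinct except $v_0=v_k$. The out-degree of a vertex $v$ is the number of edges with initial vertex $v$. The notation $a_n\sim b_n$ means $a_n/b_n\to 1$ as $n\to\infty$. The series $F$ defines an entire function; $\alpha$ is its isolated real zero whose value is $-1.488$ to three decimal places. (In the source, $O_n$ is also the number of orientable small covers over the $n$-cube, and $R_n$ the number of all small covers over the $n$-cube, up to Davis–Januszkiewicz equivalence; the claim is about the digraph counts just defined.) *)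

theory Defs
  imports
    "HOL-Analysis.Analysis"
    "HOL-Library.Landau_Symbols"
    "Graph_Theory.Pair_Digraph"
begin

text \<open>
  A simple digraph is a \<^typ>\<open>'a pair_pre_digraph\<close> (its arcs form a set of pairs, so there are
  no parallel arcs) satisfying the locale \<^locale>\<open>pair_digraph\<close> (finite, arcs join vertices,
  no loops).
\<close>

definition acyclic_digraph :: "'a pair_pre_digraph \<Rightarrow> bool" where
  "acyclic_digraph G \<longleftrightarrow> \<not> (\<exists>p. pre_digraph.cycle (with_proj G) p)"

definition labelled_acyclic_digraphs :: "nat \<Rightarrow> nat pair_pre_digraph set" where
  "labelled_acyclic_digraphs n = {G. pverts G = {1..n} \<and> pair_digraph G \<and> acyclic_digraph G}"

definition R :: "nat \<Rightarrow> nat" where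
  "R n = card (labelled_acyclic_digraphs n)"

definition O_even :: "nat \<Rightarrow> nat" where
  "O_even n = card {G \<in> labelled_acyclic_digraphs n.
     \<forall>v \<in> pverts G. even (out_degree (with_proj G) v)}"

definition F :: "'a :: {real_normed_field, banach} \<Rightarrow> 'a" where
  "F x = (\<Sum>n. x ^ n / (fact n * 2 ^ (n choose 2)))"

text \<open>The description is proper: see \<open>ex1_zero_F\<close> and \<open>alpha\<close> below.\<close>

definition \<alpha> :: real where
  "\<alpha> = (THE x. F x = 0 \<and> \<bar>x - (- 1.488)\<bar> < 0.0005)"

definition K :: real where
  "K = - ((1 - F (2 * \<alpha>)) / (\<alpha> * F (\<alpha> / 2)))"

definition C :: real where
  "C = - (1 / (\<alpha> * F (\<alpha> / 2)))"

lemma summable_F: "summable (\<lambda>n. (x::real) ^ n / (fact n * 2 ^ (n choose 2)))"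
proof (rule summable_comparison_test')
  show "summable (\<lambda>n. \<bar>x\<bar> ^ n / fact n)"
    using summable_exp[of "\<bar>x\<bar>"] by (simp add: field_simps)
  show "norm (x ^ n / (fact n * 2 ^ (n choose 2))) \<le> \<bar>x\<bar> ^ n / fact n" if "n \<ge> 0" for n
  proof -
    have "(1::real) \<le> 2 ^ (n choose 2)" by simp
    then have "(fact n :: real) * 1 \<le> fact n * 2 ^ (n choose 2)"
      by (intro mult_left_mono) auto
    then show ?thesis
      by (auto simp: abs_mult power_abs intro!: divide_left_mono)
  qed
qed

lemma DERIV_F: "(F has_real_derivative F (x / 2)) (at (x :: real))"
proof -
  define c :: "nat \<Rightarrow> real" where "c n = 1 / (fact n * 2 ^ (n choose 2))" for n
  have F_eq: "F = (\<lambda>x. \<Sum>n. c n * x ^ n)"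
    by (rule ext) (simp add: F_def c_def)
  have summ: "summable (\<lambda>n. c n * y ^ n)" for y
    using summable_F[of y] by (simp add: c_def)
  have "diffs c n * x ^ n = c n * (x / 2) ^ n" for n
  proof -
    have "Suc n choose 2 = n + (n choose 2)"
      by (simp add: numeral_2_eq_2)
    then show ?thesis
      by (simp add: diffs_def c_def power_add power_divide del: of_nat_Suc)
  qed
  then have "(\<Sum>n. diffs c n * x ^ n) = F (x / 2)"
    by (simp add: F_eq)
  moreover have "((\<lambda>x. \<Sum>n. c n * x ^ n) has_real_derivative (\<Sum>n. diffs c n * x ^ n)) (at x)"
    by (rule termdiffs_strong_converges_everywhere) (rule summ)
  ultimately show ?thesis
    by (simp add: F_eq)
qed

lemma F_tail:
  assumes "\<bar>x::real\<bar> \<le> 2" "N \<ge> 2"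
  shows "\<bar>F x - (\<Sum>n<N. x ^ n / (fact n * 2 ^ (n choose 2)))\<bar>
    \<le> 2 * (2 ^ N / (fact N * 2 ^ (N choose 2)))"
proof -
  define t :: "nat \<Rightarrow> real" where "t n = 2 ^ n / (fact n * 2 ^ (n choose 2))" for n
  define f where "f n = x ^ n / (fact n * 2 ^ (n choose 2))" for n
  have t0: "t n \<ge> 0" for n by (simp add: t_def)
  have step: "t (Suc n) \<le> t n / 2" if "n \<ge> 2" for n
  proof -
    have "Suc n choose 2 = n + (n choose 2)"
      by (simp add: numeral_2_eq_2)
    then have "t (Suc n) = t n * (2 / (real (Suc n) * 2 ^ n))"
      by (simp add: t_def power_add field_simps)
    also have "\<dots> \<le> t n * (1 / 2)"
    proof (rule mult_left_mono[OF _ t0])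
      have "(2::real) ^ 2 \<le> 2 ^ n" using that by (intro power_increasing) auto
      then have "1 * 4 \<le> real (Suc n) * 2 ^ n" by (intro mult_mono) auto
      then show "2 / (real (Suc n) * 2 ^ n) \<le> 1 / 2"
        by (simp add: divide_simps del: of_nat_Suc)
    qed
    finally show ?thesis by simp
  qed
  have geo: "t (n + N) \<le> t N * (1 / 2) ^ n" for n
  proof (induction n)
    case (Suc n)
    with step[of "n + N"] assms show ?case by simp
  qed simp
  have ft: "norm (f n) \<le> t n" for n
    using power_mono[OF assms(1), of n]
    by (simp add: f_def t_def power_abs abs_mult divide_right_mono)
  have sf: "summable f" unfolding f_def by (rule summable_F)
  have sg: "summable (\<lambda>n. t N * (1 / 2) ^ n)"
    by (intro summable_mult summable_geometric) auto
  have "F x - (\<Sum>n<N. f n) = (\<Sum>n. f (n + N))"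
    using suminf_minus_initial_segment[OF sf, of N] by (simp add: F_def f_def)
  moreover have "norm (\<Sum>n. f (n + N)) \<le> (\<Sum>n. t N * (1 / 2) ^ n)"
    using order_trans[OF ft geo] sg by (intro norm_suminf_le) auto
  moreover have "(\<Sum>n. t N * (1 / 2) ^ n) = 2 * t N"
    by (subst suminf_mult) (auto simp: suminf_geometric)
  ultimately show ?thesis by (simp add: f_def t_def)
qed

lemma ex1_zero_F: "\<exists>!x::real. F x = 0 \<and> \<bar>x - (- 1.488)\<bar> < 0.0005"
proof -
  have pos: "F (x / 2) > 0" if "- 1.4885 \<le> x" "x \<le> - 1.4875" for x :: real
  proof -
    define y where "y = x / 2"
    have y: "- 3 / 4 \<le> y" "\<bar>y\<bar> \<le> 1" using that by (auto simp: y_def)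
    have "\<bar>F y - (1 + y + y\<^sup>2 / 4 + y ^ 3 / 48)\<bar> \<le> 1 / 48"
      using F_tail[of y 4] y
      by (simp add: eval_nat_numeral fact_numeral lessThan_Suc algebra_simps)
    moreover have "0 \<le> y\<^sup>2" by simp
    moreover have "\<bar>y ^ 3\<bar> \<le> 1" using y by (simp add: power_abs power_le_one)
    ultimately have "F y > 0" using y by linarith
    then show ?thesis by (simp add: y_def)
  qed
  have poly: "\<bar>F x - (1 + x + x ^ 2 / 4 + x ^ 3 / 48 + x ^ 4 / 1536 + x ^ 5 / 122880)\<bar>
      \<le> 2 * (2 ^ 6 / (720 * 32768))" if "\<bar>x\<bar> \<le> 2" for x :: real
    using F_tail[of x 6] that
    by (simp add: eval_nat_numeral fact_numeral lessThan_Suc algebra_simps)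
  have neg1: "F (- 1.4885 :: real) < 0"
    using poly[of "- 1.4885"] unfolding abs_le_iff
    by (simp add: power_divide eval_nat_numeral)
  have pos1: "F (- 1.4875 :: real) > 0"
    using poly[of "- 1.4875"] unfolding abs_le_iff
    by (simp add: power_divide eval_nat_numeral)
  have mono: "F x < F y" if "- 1.4885 \<le> x" "x < y" "y \<le> - 1.4875" for x y :: real
    using that pos by (intro DERIV_pos_imp_increasing[of x y F]) (auto intro!: exI DERIV_F)
  have "\<exists>x::real. - 1.4885 \<le> x \<and> x \<le> - 1.4875 \<and> F x = 0"
    using neg1 pos1 by (intro IVT) (auto intro: DERIV_isCont DERIV_F)
  then obtain z :: real where z: "- 1.4885 \<le> z" "z \<le> - 1.4875" "F z = 0" by blast
  moreover have "z \<noteq> - 1.4885" "z \<noteq> - 1.4875" using z neg1 pos1 by auto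
  ultimately have "F z = 0 \<and> \<bar>z - (- 1.488)\<bar> < 0.0005"
    unfolding abs_less_iff by simp
  then show ?thesis
  proof (rule ex1I)
    fix y :: real assume "F y = 0 \<and> \<bar>y - (- 1.488)\<bar> < 0.0005"
    then have y: "F y = 0" "- 1.4885 \<le> y" "y \<le> - 1.4875"
      unfolding abs_less_iff by auto
    then show "y = z" using mono[of y z] mono[of z y] z by (cases y z rule: linorder_cases) auto
  qed
qed

lemma alpha: "F \<alpha> = 0" "\<bar>\<alpha> - (- 1.488)\<bar> < 0.0005"
  using theI'[OF ex1_zero_F] unfolding \<alpha>_def by blast+

end

theory Submission
  imports Defs "HOL-Computational_Algebra.Formal_Power_Series"
begin

text \<open>
  Two recurrences of Robinson type drive the proof. Inclusion--exclusion over the set of sources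
  (\<open>dags_inclusion_exclusion\<close>) works for all acyclic digraphs and for those with even out-degrees
  alike. The only difference is the number of out-neighbourhoods that a source may have among the
  remaining \<open>m\<close> vertices: \<open>2 ^ m\<close> in the first case, \<open>2 ^ (m - 1)\<close> (for \<open>m \<ge> 1\<close>) in the
  second. For the generating functions \<open>r\<close> and \<open>o\<close> of the two counts divided by
  \<open>n! * 2 ^ (n choose 2)\<close>, the latter without constant term, this gives
  \<open>r(x) = 1 / F(- x)\<close> and \<open>o(x) = (1 - F(- x)) / F(- x / 2)\<close>. Their dominant singularities are
  the simple poles \<open>- \<alpha>\<close> and \<open>- 2 * \<alpha>\<close>, so the coefficients of \<open>r\<close> behave like
  \<open>C * (- \<alpha>) ^ (- n)\<close> and those of \<open>o\<close> like \<open>K * (- 2 * \<alpha>) ^ (- n)\<close>. Dividing one by the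
  other, the normalising factors cancel and \<open>K / (C * 2 ^ n)\<close> remains.

  No complex zeros of \<open>F\<close> are needed to see that these poles dominate. After rescaling by the
  pole, the series of \<open>F\<close> at \<open>\<alpha>\<close> becomes a sequence \<open>c\<close> with sum 0, and dividing its
  generating function by \<open>1 - x\<close> leaves the sequence \<open>g\<close> of partial sums of \<open>c\<close>, which starts
  with 1. The remaining entries of \<open>g\<close> have absolute values that add up to less than 1
  (\<open>F_minus_alpha\<close>), so \<open>g\<close> is invertible among the absolutely summable sequences. Hence the
  rescaled coefficients have summable differences, and their limit is found by evaluating the
  generating functions at 1 (\<open>convolution_quotient_limit\<close>).

  Since \<open>K / C = 1 - F (2 * \<alpha>)\<close>, the numerical claim concerns one value of \<open>F\<close>
  (\<open>F_twice_alpha\<close>).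
\<close>

section \<open>Acyclic digraphs as relations, and their recurrence\<close>

text \<open>
Acyclic digraphs are counted as relations. The predicate \<open>P\<close> on out-degrees lets one argument
serve both counts: it is constantly true for all acyclic digraphs and \<open>even\<close> for the
restricted ones.
\<close>

definition dags :: "(nat \<Rightarrow> bool) \<Rightarrow> 'a set \<Rightarrow> 'a rel set" where
  "dags P V = {E. E \<subseteq> V \<times> V \<and> acyclic E \<and> (\<forall>v\<in>V. P (card (E `` {v})))}"

lemma finite_dags: "finite V \<Longrightarrow> finite (dags P V)"
  by (rule finite_subset[of _ "Pow (V \<times> V)"]) (auto simp: dags_def)

text \<open>
A cycle visits no vertex twice, whereas transitive closure only provides closed walks; the two
notions of acyclicity agree because every nonempty closed walk contains a cycle.
\<close>

lemma acyclic_digraph_iff: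
  assumes "pair_fin_digraph G"
  shows "acyclic_digraph G \<longleftrightarrow> acyclic (parcs G)"
proof -
  interpret pair_fin_digraph G by fact
  have "(\<exists>p. cycle p) \<longleftrightarrow> (\<exists>p. closed_w p)"
    using closed_w_imp_cycle by (auto simp: cycle_altdef)
  also have "\<dots> \<longleftrightarrow> (\<exists>u. (u, u) \<in> (parcs G)\<^sup>+)"
    using reachable1_awalk by (auto simp: closed_w_def)
  finally show ?thesis
    by (simp add: acyclic_digraph_def acyclic_def)
qed

lemma out_degree_with_proj: "out_degree (with_proj G) v = card (parcs G `` {v})"
proof -
  have "out_arcs (with_proj G) v = Pair v ` (parcs G `` {v})"
    by (auto simp: out_arcs_def)
  then show ?thesis
    by (simp add: out_degree_def card_image inj_on_def)
qed

text \<open>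
A digraph with a fixed vertex set is determined by its arcs, and looplessness is a consequence
of acyclicity.
\<close>

lemma card_labelled_acyclic_digraphs:
  "card {G \<in> labelled_acyclic_digraphs n. \<forall>v \<in> pverts G. P (out_degree (with_proj G) v)}
    = card (dags P {1..n})"
proof -
  let ?L = "{G \<in> labelled_acyclic_digraphs n. \<forall>v \<in> pverts G. P (out_degree (with_proj G) v)}"
  have pair_digraph: "pair_digraph \<lparr>pverts = V, parcs = E\<rparr>"
    if "E \<subseteq> V \<times> V" "acyclic E" "finite V" for E :: "nat rel" and V
    using that finite_subset[OF that(1)] by unfold_locales (auto simp: acyclic_def dest: r_into_trancl)
  have "bij_betw parcs ?L (dags P {1..n})"
  proof (rule bij_betw_byWitness[where f' = "\<lambda>E. \<lparr>pverts = {1..n}, parcs = E\<rparr>"])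
    show "parcs ` ?L \<subseteq> dags P {1..n}"
    proof safe
      fix G :: "nat pair_pre_digraph"
      assume G: "G \<in> labelled_acyclic_digraphs n" "\<forall>v\<in>pverts G. P (out_degree (with_proj G) v)"
      then interpret pair_digraph G by (simp add: labelled_acyclic_digraphs_def)
      show "parcs G \<in> dags P {1..n}"
        using G acyclic_digraph_iff[OF pair_fin_digraph_axioms]
        by (auto simp: labelled_acyclic_digraphs_def dags_def out_degree_with_proj
            dest: in_arcsD1 in_arcsD2)
    qed
    show "(\<lambda>E. \<lparr>pverts = {1..n}, parcs = E\<rparr>) ` dags P {1..n} \<subseteq> ?L"
    proof safe
      fix E assume E: "E \<in> dags P {1..n}"
      then interpret pair_digraph "\<lparr>pverts = {1..n}, parcs = E\<rparr>"
        by (intro pair_digraph) (auto simp: dags_def)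
      show "\<lparr>pverts = {1..n}, parcs = E\<rparr> \<in> labelled_acyclic_digraphs n"
        using E acyclic_digraph_iff[OF pair_fin_digraph_axioms] pair_digraph_axioms
        by (simp add: labelled_acyclic_digraphs_def dags_def)
      show "P (out_degree (with_proj \<lparr>pverts = {1..n}, parcs = E\<rparr>) v)"
        if "v \<in> pverts \<lparr>pverts = {1..n}, parcs = E\<rparr>" for v
        using E that by (simp add: dags_def out_degree_with_proj)
    qed
  qed (auto simp: labelled_acyclic_digraphs_def)
  then show ?thesis by (rule bij_betw_same_card)
qed

text \<open>
If the vertices in \<open>S\<close> are sources, then all arcs end in \<open>V - S\<close>. So the digraph
splits into an arbitrary choice of out-neighbourhoods in \<open>V - S\<close> for the elements of \<open>S\<close>,
restricted only by \<open>P\<close>, and an admissible digraph on \<open>V - S\<close>. No choice creates a cycle,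
since a walk that has left \<open>S\<close> never returns.
\<close>

lemma card_dags_sources_superset:
  assumes "finite V" "S \<subseteq> V"
  shows "card {E \<in> dags P V. S \<subseteq> V - Range E}
    = card {T. T \<subseteq> V - S \<and> P (card T)} ^ card S * card (dags P (V - S))"
proof -
  let ?T = "{T. T \<subseteq> V - S \<and> P (card T)}"
  let ?L = "{E \<in> dags P V. S \<subseteq> V - Range E}"
  let ?R = "(PiE S (\<lambda>_. ?T)) \<times> dags P (V - S)"
  let ?f = "\<lambda>E. (\<lambda>s\<in>S. E `` {s}, E \<inter> (V - S) \<times> (V - S))"
  let ?g = "\<lambda>(h, E). Sigma S h \<union> E"
  have "bij_betw ?f ?L ?R"
  proof (rule bij_betw_byWitness[where f' = ?g])
    show "\<forall>E\<in>?L. ?g (?f E) = E"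
      by (auto simp: dags_def)
    show "\<forall>p\<in>?R. ?f (?g p) = p"
    proof
      fix p assume "p \<in> ?R"
      then obtain h E where p: "p = (h, E)" and h: "h \<in> PiE S (\<lambda>_. ?T)"
        and E: "E \<in> dags P (V - S)" by auto
      have "(\<lambda>s\<in>S. ?g (h, E) `` {s}) = h"
        using h E by (intro ext) (auto simp: dags_def PiE_def extensional_def restrict_def)
      moreover have "?g (h, E) \<inter> (V - S) \<times> (V - S) = E"
        using E by (auto simp: dags_def)
      ultimately show "?f (?g p) = p" by (simp add: p)
    qed
    show "?f ` ?L \<subseteq> ?R"
    proof (rule image_subsetI)
      fix E assume "E \<in> ?L"
      then have E: "E \<in> dags P V" "S \<subseteq> V - Range E" by auto
      have "(\<lambda>s\<in>S. E `` {s}) \<in> PiE S (\<lambda>_. ?T)"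
        using E assms(2) by (auto simp: dags_def)
      moreover have "(E \<inter> (V - S) \<times> (V - S)) `` {v} = E `` {v}" if "v \<in> V - S" for v
        using E that by (auto simp: dags_def)
      then have "E \<inter> (V - S) \<times> (V - S) \<in> dags P (V - S)"
        using E by (auto simp: dags_def intro: acyclic_subset)
      ultimately show "?f E \<in> ?R" by simp
    qed
    show "?g ` ?R \<subseteq> ?L"
    proof (rule image_subsetI)
      fix p assume "p \<in> ?R"
      then obtain h E where p: "p = (h, E)" and h: "h \<in> PiE S (\<lambda>_. ?T)"
        and E: "E \<in> dags P (V - S)" by auto
      have h': "h s \<subseteq> V - S" "P (card (h s))" if "s \<in> S" for s
        using PiE_mem[OF h that] by auto
      have fin: "finite E"
        using E assms(1) by (intro finite_subset[of E "V \<times> V"]) (auto simp: dags_def)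
      have "wf (Sigma S h \<union> E)"
      proof (rule wf_Un)
        show "wf (Sigma S h)"
          using h' by (intro wf_no_loop) auto
        show "wf E"
          using E fin by (intro finite_acyclic_wf) (auto simp: dags_def)
        show "Domain (Sigma S h) \<inter> Range E = {}"
          using E by (auto simp: dags_def)
      qed
      then have "acyclic (Sigma S h \<union> E)" by (rule wf_acyclic)
      moreover have "(Sigma S h \<union> E) `` {v} = (if v \<in> S then h v else E `` {v})" for v
        using E by (auto simp: dags_def)
      ultimately have "Sigma S h \<union> E \<in> dags P V"
        using h' E assms(2) by (auto simp: dags_def)
      moreover have "S \<subseteq> V - Range (Sigma S h \<union> E)"
        using h' E assms(2) by (auto simp: dags_def)
      ultimately show "?g p \<in> ?L" by (simp add: p)
    qed
  qed
  then have "card ?L = card ?R" by (rule bij_betw_same_card)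
  also have "\<dots> = card ?T ^ card S * card (dags P (V - S))"
    using finite_subset[OF assms(2,1)] by (simp add: card_cartesian_product card_PiE)
  finally show ?thesis .
qed

lemma sum_Pow_minus_one:
  assumes "finite X" "X \<noteq> {}"
  shows "(\<Sum>S\<in>Pow X. (- 1) ^ card S) = (0 :: int)"
proof (rule sum_alternating_cancels)
  show "card {S \<in> Pow X. even (card S)} = card {S \<in> Pow X. odd (card S)}"
    using card_subsupersets_even_odd[OF assms(1), of "{}"] assms(2) by (simp add: Pow_def psubset_eq)
qed (use assms in auto)

lemma ex_source:
  assumes "finite V" "V \<noteq> {}" "E \<in> dags P V"
  shows "V - Range E \<noteq> {}"
proof -
  have "finite E"
    using assms by (intro finite_subset[of E "V \<times> V"]) (auto simp: dags_def)
  then have "wf E" using assms by (intro finite_acyclic_wf) (auto simp: dags_def)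
  then obtain z where "z \<in> V" "\<And>y. (y, z) \<in> E \<Longrightarrow> y \<notin> V"
    using assms(2) unfolding wf_eq_minimal by (metis ex_in_conv)
  then have "z \<in> V - Range E" using assms(3) by (auto simp: dags_def)
  then show ?thesis by blast
qed

text \<open>
Robinson's inclusion--exclusion over sets of sources. Summing \<open>(- 1) ^ card S\<close> over the sets
\<open>S\<close> of sources of a fixed digraph gives 0, because a nonempty finite acyclic digraph has a
source. Exchanging this sum with the sum over all digraphs leaves, for each \<open>S\<close>, the number of
digraphs in which \<open>S\<close> consists of sources. The number \<open>w m\<close> counts the admissible
out-neighbourhoods within a set of \<open>m\<close> vertices.
\<close>

lemma dags_inclusion_exclusion:
  fixes V :: "'a set"
  assumes "finite V" "V \<noteq> {}"
    and w: "\<And>U. finite U \<Longrightarrow> card {T. T \<subseteq> (U :: 'a set) \<and> P (card T)} = w (card U)"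
  shows "(\<Sum>S\<in>Pow V. (- 1) ^ card S * int (w (card (V - S)) ^ card S * card (dags P (V - S)))) = 0"
proof -
  have "(\<Sum>S\<in>Pow V. (- 1) ^ card S * int (w (card (V - S)) ^ card S * card (dags P (V - S))))
      = (\<Sum>S\<in>Pow V. (- 1) ^ card S * int (card {E \<in> dags P V. S \<subseteq> V - Range E}))"
    using assms(1) by (intro sum.cong) (auto simp: card_dags_sources_superset w)
  also have "\<dots> = (\<Sum>S\<in>Pow V. \<Sum>E | E \<in> dags P V \<and> S \<subseteq> V - Range E. (- 1) ^ card S)"
    by (simp add: mult.commute)
  also have "\<dots> = (\<Sum>E\<in>dags P V. \<Sum>S | S \<in> Pow V \<and> S \<subseteq> V - Range E. (- 1) ^ card S)"
    using assms(1) by (intro sum.swap_restrict) (auto simp: finite_dags)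
  also have "\<dots> = (\<Sum>E\<in>dags P V. \<Sum>S\<in>Pow (V - Range E). (- 1) ^ card S)"
    by (intro sum.cong) auto
  also have "\<dots> = 0"
    using assms(1,2) ex_source by (intro sum.neutral ballI sum_Pow_minus_one) auto
  finally show ?thesis .
qed

lemma sum_Pow_card:
  fixes h :: "nat \<Rightarrow> 'b :: comm_semiring_1"
  assumes "finite V"
  shows "(\<Sum>S\<in>Pow V. h (card S)) = (\<Sum>k\<le>card V. of_nat (card V choose k) * h k)"
proof -
  have "(\<Sum>S\<in>Pow V. h (card S)) = (\<Sum>k\<le>card V. \<Sum>S | S \<in> Pow V \<and> card S = k. h (card S))"
    using assms by (intro sum.group[symmetric]) (auto intro: card_mono)
  also have "\<dots> = (\<Sum>k\<le>card V. of_nat (card V choose k) * h k)"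
    using n_subsets[OF assms] by (intro sum.cong) auto
  finally show ?thesis .
qed

text \<open>
The inclusion--exclusion identity expresses the count for \<open>V\<close> by counts for smaller vertex sets
and their sizes, so that independence of the labels follows by induction without transporting
digraphs along a bijection.
\<close>

lemma card_dags_eq:
  fixes V W :: "'a set"
  assumes w: "\<And>U. finite U \<Longrightarrow> card {T. T \<subseteq> (U :: 'a set) \<and> P (card T)} = w (card U)"
  assumes "finite V" "finite W" "card V = card W"
  shows "card (dags P V) = card (dags P W)"
  using assms(2-)
proof (induction "card V" arbitrary: V W rule: less_induct)
  case less
  show ?case
  proof (cases "V = {}")
    case True
    with less.prems show ?thesis by auto
  next
    case False
    have "\<exists>X\<subseteq>V. card X = card V - k" for k
      using obtain_subset_with_card_n[of "card V - k" V] by auto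
    then obtain X where X: "\<And>k. X k \<subseteq> V" "\<And>k. card (X k) = card V - k"
      by metis
    \<comment> \<open>The term for a nonempty source set of size \<open>k\<close>; by the induction hypothesis any set with
      \<open>card V - k\<close> vertices may stand for the remaining ones. The value 0 at 0 drops the
      empty source set, whose term is the unknown count itself.\<close>
    define h where "h k = (if k = 0 then 0
      else (- 1) ^ k * int (w (card V - k) ^ k * card (dags P (X k))))" for k
    have eq: "int (card (dags P Y)) = - (\<Sum>S\<in>Pow Y. h (card S))" if "Y = V \<or> Y = W" for Y
    proof -
      have Y: "finite Y" "Y \<noteq> {}" "card Y = card V" using that less.prems False by auto
      have "h (card S) = (- 1) ^ card S * int (w (card (Y - S)) ^ card S * card (dags P (Y - S)))"
        if S: "S \<in> Pow Y - {{}}" for S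
      proof -
        have finS: "finite S" "card S > 0" "card S \<le> card Y"
          using S Y card_mono[of Y S] by (auto simp: card_gt_0_iff intro: finite_subset)
        have c: "card (Y - S) = card V - card S"
          using S Y finS by (auto simp: card_Diff_subset)
        have "finite (X (card S))"
          using X(1) less.prems(1) by (rule finite_subset)
        then have "card (dags P (Y - S)) = card (dags P (X (card S)))"
          using Y finS c X(2) less.prems by (intro less.hyps) auto
        then show ?thesis using finS c by (auto simp: h_def)
      qed
      then have "(\<Sum>S\<in>Pow Y - {{}}. h (card S)) = (\<Sum>S\<in>Pow Y - {{}}.
          (- 1) ^ card S * int (w (card (Y - S)) ^ card S * card (dags P (Y - S))))"
        by (intro sum.cong) auto
      with dags_inclusion_exclusion[OF Y(1,2) w] show ?thesis
        using Y by (simp add: sum.remove[of "Pow Y" "{}"] h_def)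
    qed
    have "int (card (dags P V)) = int (card (dags P W))"
      unfolding eq[OF disjI1[OF refl]] eq[OF disjI2[OF refl]]
      using less.prems by (simp add: sum_Pow_card)
    then show ?thesis by simp
  qed
qed

lemma dags_recurrence:
  fixes n :: nat
  assumes w: "\<And>U :: nat set. finite U \<Longrightarrow> card {T. T \<subseteq> U \<and> P (card T)} = w (card U)"
    and n: "n > 0"
  shows "(\<Sum>k\<le>n. (- 1) ^ k * real (n choose k) * real (w (n - k)) ^ k
    * real (card (dags P {1..n - k}))) = 0"
proof -
  define h where "h k = (- 1) ^ k * int (w (n - k) ^ k * card (dags P {1..n - k}))" for k
  have "0 = (\<Sum>S\<in>Pow {1..n}. (- 1) ^ card S *
      int (w (card ({1..n} - S)) ^ card S * card (dags P ({1..n} - S))))"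
    by (rule dags_inclusion_exclusion[symmetric]) (use n w in auto)
  also have "\<dots> = (\<Sum>S\<in>Pow {1..n}. h (card S))"
  proof (rule sum.cong)
    fix S assume S: "S \<in> Pow {1..n}"
    then have c: "card ({1..n} - S) = n - card S"
      by (simp add: card_Diff_subset finite_subset[of S "{1..n}"])
    then have "card (dags P ({1..n} - S)) = card (dags P {1..n - card S})"
      by (intro card_dags_eq[where w = w] w) auto
    with c show "(- 1) ^ card S * int (w (card ({1..n} - S)) ^ card S * card (dags P ({1..n} - S)))
        = h (card S)" by (simp add: h_def)
  qed simp
  also have "\<dots> = (\<Sum>k\<le>n. int (n choose k) * h k)"
    by (simp add: sum_Pow_card)
  finally have "(\<Sum>k\<le>n. int (n choose k) * h k) = 0" by simp
  then have "real_of_int (\<Sum>k\<le>n. int (n choose k) * h k) = 0" by simp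
  then show ?thesis
    by (simp add: h_def mult_ac)
qed

lemma card_even_subsets:
  assumes "finite U"
  shows "card {T. T \<subseteq> U \<and> even (card T)} = 2 ^ (card U - 1)"
proof (cases "U = {}")
  case True
  then have "{T. T \<subseteq> U \<and> even (card T)} = {{}}" by auto
  then show ?thesis using True by simp
next
  case False
  let ?A = "{T. T \<subseteq> U \<and> even (card T)}" and ?B = "{T. T \<subseteq> U \<and> odd (card T)}"
  have "2 ^ card U = card (Pow U)" using assms by (simp add: card_Pow)
  also have "Pow U = ?A \<union> ?B" by auto
  also have "card \<dots> = card ?A + card ?B"
    using assms by (intro card_Un_disjoint) auto
  also have "card ?B = card ?A"
    using card_subsupersets_even_odd[OF assms, of "{}"] False by (simp add: psubset_eq)
  finally have "2 * card ?A = 2 ^ card U" by simp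
  also have "\<dots> = 2 * 2 ^ (card U - 1)"
    using False assms by (cases "card U") auto
  finally show ?thesis by simp
qed

section \<open>Limits of convolution quotients\<close>

text \<open>
Summation by parts: \<open>a j\<close> belongs to exactly \<open>j\<close> of the tails that start after some index
\<open>k \<ge> 0\<close>. The boundary term \<open>N\<close> times the tail from \<open>N\<close> vanishes in the limit, as it is
dominated by a tail of the series of \<open>j * \<bar>a j\<bar>\<close>.
\<close>

lemma sums_tails:
  fixes a :: "nat \<Rightarrow> real"
  assumes "summable (\<lambda>j. real j * \<bar>a j\<bar>)"
  shows "summable a" and "(\<lambda>k. \<Sum>j. a (j + Suc k)) sums (\<Sum>j. real j * a j)"
proof -
  have le: "\<bar>a j\<bar> \<le> real j * \<bar>a j\<bar>" if "j \<ge> 1" for j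
    using that mult_right_mono[of 1 "real j" "\<bar>a j\<bar>"] by simp
  show a: "summable a"
    by (rule summable_comparison_test'[OF assms, of 1]) (use le in auto)
  have abs: "summable (\<lambda>j. \<bar>a j\<bar>)"
    by (rule summable_comparison_test'[OF assms, of 1]) (use le in auto)
  have ja: "summable (\<lambda>j. real j * a j)"
    by (rule summable_rabs_cancel) (use assms in \<open>simp add: abs_mult\<close>)
  have tail: "(\<Sum>j. a (j + N)) = (\<Sum>j. a j) - (\<Sum>j<N. a j)" for N
    by (rule suminf_minus_initial_segment[OF a])
  have partial: "(\<Sum>k<N. \<Sum>j. a (j + Suc k)) = (\<Sum>j<N. real j * a j) + real N * (\<Sum>j. a (j + N))" for N
  proof (induction N)
    case (Suc N)
    then show ?case unfolding sum.lessThan_Suc[of _ N] tail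
      by (simp add: algebra_simps)
  qed simp
  have "(\<lambda>N. real N * (\<Sum>j. a (j + N))) \<longlonglongrightarrow> 0"
  proof (rule Lim_null_comparison)
    show "(\<lambda>N. \<Sum>j. real (j + N) * \<bar>a (j + N)\<bar>) \<longlonglongrightarrow> 0"
      using suminf_exist_split2[OF assms] .
    have "norm (real N * (\<Sum>j. a (j + N))) \<le> (\<Sum>j. real (j + N) * \<bar>a (j + N)\<bar>)" for N
    proof -
      have s: "summable (\<lambda>j. \<bar>a (j + N)\<bar>)"
        using abs by (rule summable_ignore_initial_segment)
      have "norm (real N * (\<Sum>j. a (j + N))) \<le> real N * (\<Sum>j. \<bar>a (j + N)\<bar>)"
        using summable_rabs[OF s] by (simp add: abs_mult mult_left_mono)
      also have "\<dots> = (\<Sum>j. real N * \<bar>a (j + N)\<bar>)"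
        using s by (rule suminf_mult[symmetric])
      also have "\<dots> \<le> (\<Sum>j. real (j + N) * \<bar>a (j + N)\<bar>)"
        using s summable_ignore_initial_segment[OF assms, of N]
        by (intro suminf_le) (auto intro: summable_mult mult_right_mono)
      finally show ?thesis .
    qed
    then show "\<forall>\<^sub>F N in sequentially. norm (real N * (\<Sum>j. a (j + N))) \<le> (\<Sum>j. real (j + N) * \<bar>a (j + N)\<bar>)"
      by simp
  qed
  with summable_LIMSEQ[OF ja]
  have "(\<lambda>N. (\<Sum>j<N. real j * a j) + real N * (\<Sum>j. a (j + N))) \<longlonglongrightarrow> (\<Sum>j. real j * a j) + 0"
    by (rule tendsto_add)
  then show "(\<lambda>k. \<Sum>j. a (j + Suc k)) sums (\<Sum>j. real j * a j)"
    unfolding sums_def partial by simp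
qed

text \<open>
Division in the Banach algebra of absolutely summable sequences under convolution: \<open>g\<close> is the
unit plus a sequence of norm below 1, hence invertible. The proof bounds the partial sums \<open>S\<close>
of \<open>\<bar>w n\<bar>\<close> by \<open>S \<le> (\<Sum>n. \<bar>e n\<bar>) + \<theta> * S\<close>, where \<open>\<theta> < 1\<close> is that norm.
\<close>

lemma summable_convolution_quotient:
  fixes g w e :: "nat \<Rightarrow> real"
  assumes g: "summable (\<lambda>k. \<bar>g k\<bar>)" "g 0 = 1" "(\<Sum>k. \<bar>g (Suc k)\<bar>) < 1"
    and e: "summable (\<lambda>n. \<bar>e n\<bar>)"
    and conv: "\<And>n. (\<Sum>k\<le>n. g k * w (n - k)) = e n"
  shows "summable (\<lambda>n. \<bar>w n\<bar>)"
proof -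
  define \<theta> where "\<theta> = (\<Sum>k. \<bar>g (Suc k)\<bar>)"
  have gS: "summable (\<lambda>k. \<bar>g (Suc k)\<bar>)"
    using g(1) by (subst summable_Suc_iff)
  have wn: "\<bar>w n\<bar> \<le> \<bar>e n\<bar> + (\<Sum>k<n. \<bar>g (Suc k)\<bar> * \<bar>w (n - Suc k)\<bar>)" for n
  proof -
    have "e n = w n + (\<Sum>k<n. g (Suc k) * w (n - Suc k))"
      unfolding conv[symmetric] by (cases n) (simp_all add: sum.atMost_Suc_shift lessThan_Suc_atMost g(2) del: sum.atMost_Suc)
    then have "w n = e n - (\<Sum>k<n. g (Suc k) * w (n - Suc k))" by simp
    then have "\<bar>w n\<bar> \<le> \<bar>e n\<bar> + \<bar>\<Sum>k<n. g (Suc k) * w (n - Suc k)\<bar>" by simp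
    also have "\<bar>\<Sum>k<n. g (Suc k) * w (n - Suc k)\<bar> \<le> (\<Sum>k<n. \<bar>g (Suc k)\<bar> * \<bar>w (n - Suc k)\<bar>)"
      by (rule order_trans[OF sum_abs]) (simp add: abs_mult)
    finally show ?thesis by simp
  qed
  have bound: "(\<Sum>n<N. \<bar>w n\<bar>) \<le> (\<Sum>n. \<bar>e n\<bar>) / (1 - \<theta>)" for N
  proof -
    let ?S = "\<Sum>n<N. \<bar>w n\<bar>"
    have "(\<Sum>n<N. \<Sum>k<n. \<bar>g (Suc k)\<bar> * \<bar>w (n - Suc k)\<bar>)
        = (\<Sum>n<N. \<Sum>k | k \<in> {..<N} \<and> k < n. \<bar>g (Suc k)\<bar> * \<bar>w (n - Suc k)\<bar>)"
      by (intro sum.cong refl) auto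
    also have "\<dots> = (\<Sum>k<N. \<Sum>n | n \<in> {..<N} \<and> k < n. \<bar>g (Suc k)\<bar> * \<bar>w (n - Suc k)\<bar>)"
      by (intro sum.swap_restrict) auto
    also have "\<dots> \<le> (\<Sum>k<N. \<bar>g (Suc k)\<bar> * ?S)"
    proof (rule sum_mono)
      fix k
      have "(\<Sum>n | n \<in> {..<N} \<and> k < n. \<bar>w (n - Suc k)\<bar>)
          = (\<Sum>m\<in>(\<lambda>n. n - Suc k) ` {n \<in> {..<N}. k < n}. \<bar>w m\<bar>)"
        by (subst sum.reindex) (auto simp: inj_on_def)
      also have "\<dots> \<le> ?S"
        by (rule sum_mono2) auto
      finally show "(\<Sum>n | n \<in> {..<N} \<and> k < n. \<bar>g (Suc k)\<bar> * \<bar>w (n - Suc k)\<bar>) \<le> \<bar>g (Suc k)\<bar> * ?S"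
        unfolding sum_distrib_left[symmetric] by (rule mult_left_mono) simp
    qed
    also have "\<dots> \<le> \<theta> * ?S"
      unfolding sum_distrib_right[symmetric] \<theta>_def
      by (intro mult_right_mono sum_le_suminf gS) (auto intro: sum_nonneg)
    finally have "(\<Sum>n<N. \<Sum>k<n. \<bar>g (Suc k)\<bar> * \<bar>w (n - Suc k)\<bar>) \<le> \<theta> * ?S" .
    moreover have "?S \<le> (\<Sum>n<N. \<bar>e n\<bar>) + (\<Sum>n<N. \<Sum>k<n. \<bar>g (Suc k)\<bar> * \<bar>w (n - Suc k)\<bar>)"
      unfolding sum.distrib[symmetric] by (rule sum_mono) (rule wn)
    moreover have "(\<Sum>n<N. \<bar>e n\<bar>) \<le> (\<Sum>n. \<bar>e n\<bar>)"
      by (intro sum_le_suminf e) auto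
    ultimately have "(1 - \<theta>) * ?S \<le> (\<Sum>n. \<bar>e n\<bar>)" by (simp add: algebra_simps)
    with g(3) show ?thesis by (simp add: \<theta>_def pos_le_divide_eq mult.commute)
  qed
  show ?thesis
    by (rule summableI_nonneg_bounded) (use bound in auto)
qed

text \<open>
In terms of generating functions, \<open>c(x) v(x) = e(x)\<close> where \<open>c\<close> vanishes at 1. Dividing out
the factor \<open>1 - x\<close> gives \<open>c(x) = (1 - x) g(x)\<close> with \<open>g(1) = - c'(1)\<close>, and the
differences of \<open>v\<close> have the generating function \<open>e(x) / g(x)\<close>. If \<open>1 / g\<close> has absolutely
summable coefficients, these differences are summable with sum \<open>e(1) / g(1)\<close>, which is the
limit of \<open>v\<close>. The coefficients of \<open>g\<close> are negated tails of \<open>c\<close>, and the assumption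
\<open>small\<close> bounds the sum of the tails of \<open>\<bar>c j\<bar>\<close> beyond the first one by a number below 1,
so that \<open>g\<close> is invertible by the preceding lemma. This replaces the search for the complex
zeros of \<open>c\<close> in a neighbourhood of the unit disc.
\<close>

lemma convolution_quotient_limit:
  fixes c e v :: "nat \<Rightarrow> real"
  assumes c: "summable (\<lambda>j. real j * \<bar>c j\<bar>)" "c 0 = 1" "(\<Sum>j. c j) = 0"
    and small: "(\<Sum>j. real j * \<bar>c j\<bar>) < (\<Sum>j. \<bar>c j\<bar>)"
    and e: "summable (\<lambda>n. \<bar>e n\<bar>)"
    and conv: "\<And>n. (\<Sum>k\<le>n. c k * v (n - k)) = e n"
  shows "(\<Sum>j. real j * c j) < 0"
    and "v \<longlonglongrightarrow> (\<Sum>n. e n) / - (\<Sum>j. real j * c j)"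
proof -
  define g where "g k = (\<Sum>j\<le>k. c j)" for k
  define w where "w n = (if n = 0 then v 0 else v n - v (n - 1))" for n
  have g0: "g 0 = 1" by (simp add: g_def c)
  have sc: "summable c" by (rule sums_tails(1)[OF c(1)])
  have c': "summable (\<lambda>j. real j * \<bar>\<bar>c j\<bar>\<bar>)" using c(1) by simp
  have sac: "summable (\<lambda>j. \<bar>c j\<bar>)" by (rule sums_tails(1)[OF c'])
  have g_tail: "g k = - (\<Sum>j. c (j + Suc k))" for k
    using suminf_minus_initial_segment[OF sc, of "Suc k"] c(3)
    by (simp add: g_def lessThan_Suc_atMost)
  have g_sums: "g sums - (\<Sum>j. real j * c j)"
    unfolding g_tail[abs_def] by (intro sums_minus sums_tails(2)[OF c(1)])
  have tails: "(\<lambda>k. \<Sum>j. \<bar>c (j + Suc k)\<bar>) sums (\<Sum>j. real j * \<bar>c j\<bar>)"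
    using sums_tails(2)[OF c'] .
  have g_le: "\<bar>g k\<bar> \<le> (\<Sum>j. \<bar>c (j + Suc k)\<bar>)" for k
    unfolding g_tail abs_minus_cancel
    by (rule summable_rabs) (rule summable_ignore_initial_segment[OF sac])
  have g_abs: "summable (\<lambda>k. \<bar>g k\<bar>)"
    by (rule summable_comparison_test'[OF sums_summable[OF tails], of 0]) (use g_le in auto)
  have gS: "summable (\<lambda>k. \<bar>g (Suc k)\<bar>)"
    using g_abs by (subst summable_Suc_iff)
  have tailsS: "(\<lambda>k. \<Sum>j. \<bar>c (j + Suc (Suc k))\<bar>) sums
      ((\<Sum>j. real j * \<bar>c j\<bar>) - (\<Sum>j. \<bar>c (j + Suc 0)\<bar>))"
    using tails by (subst sums_Suc_iff) simp
  have "(\<Sum>k. \<bar>g (Suc k)\<bar>) \<le> (\<Sum>j. real j * \<bar>c j\<bar>) - (\<Sum>j. \<bar>c (j + Suc 0)\<bar>)"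
    using suminf_le[OF g_le gS sums_summable[OF tailsS]] sums_unique[OF tailsS] by simp
  also have "(\<Sum>j. \<bar>c (j + Suc 0)\<bar>) = (\<Sum>j. \<bar>c j\<bar>) - 1"
    using suminf_split_head[OF sac] c(2) by simp
  finally have theta: "(\<Sum>k. \<bar>g (Suc k)\<bar>) < 1" using small by simp
  have "- (\<Sum>k. g (Suc k)) \<le> (\<Sum>k. \<bar>g (Suc k)\<bar>)"
    using summable_rabs[OF gS] by linarith
  moreover have "(\<Sum>k. g (Suc k)) = (\<Sum>k. g k) - 1"
    using suminf_split_head[OF sums_summable[OF g_sums]] g0 by simp
  ultimately have g_pos: "(\<Sum>k. g k) > 0" using theta by linarith
  then show neg: "(\<Sum>j. real j * c j) < 0"
    using sums_unique[OF g_sums] by simp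
  \<comment> \<open>Here \<open>1 - x\<close> moves from \<open>c\<close> to \<open>v\<close>: from \<open>(1 - x) g v = e\<close> to \<open>g w = e\<close> with \<open>w = (1 - x) v\<close>.\<close>
  have gw: "(\<Sum>k\<le>n. g k * w (n - k)) = e n" for n
  proof -
    have 1: "(1 - fps_X) * Abs_fps g = Abs_fps c"
      by (rule fps_ext) (auto simp: left_diff_distrib g_def c sum.atMost_Suc gr0_conv_Suc)
    have 2: "(1 - fps_X) * Abs_fps v = Abs_fps w"
      by (rule fps_ext) (auto simp: left_diff_distrib w_def)
    have "Abs_fps c * Abs_fps v = Abs_fps e"
      by (rule fps_ext) (simp add: fps_mult_nth conv atLeast0AtMost)
    then have "Abs_fps g * Abs_fps w = Abs_fps e"
      unfolding 1[symmetric] 2[symmetric] by (simp add: mult_ac)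
    then have "fps_nth (Abs_fps g * Abs_fps w) n = e n" by simp
    then show ?thesis by (simp add: fps_mult_nth atLeast0AtMost)
  qed
  have w_abs: "summable (\<lambda>n. \<bar>w n\<bar>)"
    by (rule summable_convolution_quotient[OF g_abs g0 theta e gw])
  have "(\<lambda>n. \<Sum>k\<le>n. g k * w (n - k)) sums ((\<Sum>k. g k) * (\<Sum>n. w n))"
    using g_abs w_abs by (intro Cauchy_product_sums) auto
  then have "(\<Sum>n. e n) = (\<Sum>k. g k) * (\<Sum>n. w n)"
    unfolding gw by (simp add: sums_iff)
  then have "(\<Sum>n. w n) = (\<Sum>n. e n) / - (\<Sum>j. real j * c j)"
    using g_pos sums_unique[OF g_sums] by (simp add: field_simps)
  moreover have "(\<Sum>i\<le>n. w i) = v n" for n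
    by (induction n) (auto simp: w_def)
  moreover have "(\<lambda>n. \<Sum>i\<le>n. w i) \<longlonglongrightarrow> (\<Sum>n. w n)"
    by (rule summable_LIMSEQ'[OF summable_rabs_cancel[OF w_abs]])
  ultimately show "v \<longlonglongrightarrow> (\<Sum>n. e n) / - (\<Sum>j. real j * c j)" by simp
qed

section \<open>The series F and its values near the zero\<close>

abbreviation F_term :: "real \<Rightarrow> nat \<Rightarrow> real" where
  "F_term x n \<equiv> x ^ n / (fact n * 2 ^ (n choose 2))"

lemma Suc_choose_two: "Suc n choose 2 = n + (n choose 2)"
  by (simp add: numeral_2_eq_2)

lemma sums_F: "F_term x sums F x"
  using summable_F[of x] by (simp add: F_def summable_sums)

text \<open>
The series form of \<open>x F'(x) = x F(x / 2)\<close>.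
\<close>

lemma sums_index_times_F_term: "(\<lambda>n. real n * F_term x n) sums (x * F (x / 2))"
proof -
  have "real (Suc n) * F_term x (Suc n) = x * F_term (x / 2) n" for n
    by (simp add: Suc_choose_two power_add power_divide field_simps del: of_nat_Suc)
  then have "(\<lambda>n. real (Suc n) * F_term x (Suc n)) sums (x * F (x / 2))"
    using sums_mult[OF sums_F[of "x / 2"], of x] by (simp only:)
  from sums_Suc[OF this] show ?thesis by simp
qed

lemma abs_F_term: "\<bar>F_term x n\<bar> = F_term \<bar>x\<bar> n"
  by (simp add: abs_mult power_abs)

text \<open>
From index 2 on, each majorising term is at most half of the preceding one. The range up to 4
covers the point \<open>2 \<alpha>\<close>, which lies close to \<open>- 3\<close>.
\<close>

lemma F_tail_le:
  fixes r x :: real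
  assumes "\<bar>x\<bar> \<le> r" "r \<le> 4" "N \<ge> 2"
  shows "\<bar>F x - (\<Sum>n<N. F_term x n)\<bar> \<le> 2 * F_term r N"
proof -
  have r: "0 \<le> r" using assms by linarith
  have t0: "F_term r n \<ge> 0" for n using r by simp
  have step: "F_term r (Suc n) \<le> F_term r n / 2" if "n \<ge> 2" for n
  proof -
    have "F_term r (Suc n) = F_term r n * (r / (real (Suc n) * 2 ^ n))"
      by (simp add: Suc_choose_two power_add field_simps)
    also have "\<dots> \<le> F_term r n * (1 / 2)"
    proof (rule mult_left_mono[OF _ t0])
      have "(2::real) ^ 2 \<le> 2 ^ n" using that by (intro power_increasing) auto
      then have "3 * 4 \<le> real (Suc n) * 2 ^ n" using that by (intro mult_mono) auto
      then show "r / (real (Suc n) * 2 ^ n) \<le> 1 / 2"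
        using assms(2) by (simp add: divide_simps del: of_nat_Suc)
    qed
    finally show ?thesis by simp
  qed
  have geo: "F_term r (n + N) \<le> F_term r N * (1 / 2) ^ n" for n
  proof (induction n)
    case (Suc n)
    with step[of "n + N"] assms(3) show ?case by simp
  qed simp
  have le: "norm (F_term x n) \<le> F_term r n" for n
    unfolding real_norm_def abs_F_term using assms(1) by (intro divide_right_mono power_mono) auto
  have sg: "summable (\<lambda>n. F_term r N * (1 / 2) ^ n)"
    by (intro summable_mult summable_geometric) auto
  have "F x - (\<Sum>n<N. F_term x n) = (\<Sum>n. F_term x (n + N))"
    using suminf_minus_initial_segment[OF summable_F, of x N] by (simp add: F_def)
  also have "norm \<dots> \<le> (\<Sum>n. F_term r N * (1 / 2) ^ n)"
    using order_trans[OF le geo] sg by (intro norm_suminf_le)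
  also have "\<dots> = 2 * F_term r N"
    by (subst suminf_mult) (auto simp: suminf_geometric)
  finally show ?thesis by simp
qed

text \<open>
With \<open>c\<close> the series of \<open>F\<close> at \<open>\<alpha>\<close>, this is the condition that the sum of
\<open>j * \<bar>c j\<bar>\<close> is less than that of \<open>\<bar>c j\<bar>\<close>. The two sides are about 2.81 and 3.11, so four
terms of each series suffice.
\<close>

lemma F_minus_alpha: "(- \<alpha>) * F ((- \<alpha>) / 2) < F (- \<alpha>)"
proof -
  define x where "x = - \<alpha>"
  have x: "0 \<le> x" "x \<le> 3 / 2"
    using alpha(2) unfolding x_def abs_less_iff by auto
  have approx: "\<bar>F y - (1 + y + y ^ 2 / 4 + y ^ 3 / 48)\<bar> \<le> 1 / 48" if "\<bar>y\<bar> \<le> 2" for y :: real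
    using F_tail[of y 4] that
    by (simp add: eval_nat_numeral fact_numeral lessThan_Suc algebra_simps)
  have "F x \<ge> 1 + x + x ^ 2 / 4 + x ^ 3 / 48 - 1 / 48"
    using approx[of x] x by linarith
  moreover have "x * F (x / 2) \<le> x * (1 + x / 2 + (x / 2) ^ 2 / 4 + (x / 2) ^ 3 / 48 + 1 / 48)"
    using approx[of "x / 2"] x unfolding abs_le_iff by (intro mult_left_mono) auto
  moreover have "x ^ k \<le> (3 / 2) ^ k" for k
    using x by (intro power_mono)
  from this[of 2] this[of 3] this[of 4]
  have "x * (1 + x / 2 + (x / 2) ^ 2 / 4 + (x / 2) ^ 3 / 48 + 1 / 48)
      < 1 + x + x ^ 2 / 4 + x ^ 3 / 48 - 1 / 48"
    using x by (simp add: power_divide eval_nat_numeral algebra_simps)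
  ultimately show ?thesis unfolding x_def by linarith
qed

text \<open>
The derivative of \<open>F\<close> at \<open>2 \<alpha>\<close> is \<open>F \<alpha> = 0\<close>, which makes the value insensitive to the
error of the enclosure of \<open>\<alpha>\<close>: knowing \<open>2 \<alpha>\<close> to within 0.001 is enough.
\<close>

lemma F_twice_alpha: "\<bar>(1 - F (2 * \<alpha>)) - 1.262\<bar> < 0.0005"
proof -
  \<comment> \<open>The Taylor polynomial is expanded around \<open>- 3\<close>, where its coefficients are simple
    fractions and the linear one is already small.\<close>
  define h where "h = 2 * \<alpha> + 3"
  have h: "0.023 \<le> h" "h \<le> 0.025" and x: "2 * \<alpha> = h - 3"
    using alpha(2) unfolding h_def abs_less_iff by auto
  have hk: "0.023 ^ k \<le> h ^ k" "h ^ k \<le> 0.025 ^ k" for k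
    using h by (intro power_mono; simp)+
  have "(\<Sum>n<6. F_term (h - 3) n) = - 10721 / 40960 - 37 / 8192 * h + 391 / 4096 * h ^ 2
      + 169 / 12288 * h ^ 3 + 13 / 24576 * h ^ 4 + 1 / 122880 * h ^ 5" (is "?p = _")
    by (simp add: eval_nat_numeral fact_numeral lessThan_Suc field_simps)
  then have "\<bar>?p - (- 0.2618)\<bar> < 0.0001"
    using h hk[of 2] hk[of 3] hk[of 4] hk[of 5]
    unfolding abs_less_iff by (simp add: power_divide)
  moreover have "\<bar>F (h - 3) - ?p\<bar> \<le> 0.0001"
  proof -
    have "\<bar>F (h - 3) - ?p\<bar> \<le> 2 * F_term 3 6"
      using h by (intro F_tail_le) auto
    also have "\<dots> \<le> 0.0001"
      by (simp add: eval_nat_numeral fact_numeral)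
    finally show ?thesis .
  qed
  ultimately show ?thesis
    unfolding x abs_le_iff abs_less_iff by simp
qed

section \<open>The recurrences in normalised form\<close>

lemma add_choose_two: "(k + m) choose 2 = (k choose 2) + (m choose 2) + m * k"
  by (induction k) (auto simp: Suc_choose_two)

text \<open>
The factor \<open>2 ^ (n choose 2)\<close> turns the recurrence into a plain convolution, because
\<open>n choose 2\<close> counts the pairs inside a \<open>k\<close>-set, those inside its complement, and the
\<open>(n - k) * k\<close> pairs between the two.
\<close>

lemma binomial_over_normalisation:
  assumes "k \<le> n"
  shows "real (n choose k) * 2 ^ ((n - k) * k) / (fact n * 2 ^ (n choose 2))
    = 1 / (fact k * 2 ^ (k choose 2)) * (1 / (fact (n - k) * 2 ^ ((n - k) choose 2)))"
proof -
  have "n choose 2 = (k choose 2) + ((n - k) choose 2) + (n - k) * k"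
    using add_choose_two[of k "n - k"] assms by simp
  then show ?thesis
    by (simp add: binomial_fact[OF assms] power_add)
qed

text \<open>
The two counts, divided by \<open>n! * 2 ^ (n choose 2)\<close> and multiplied by the \<open>n\<close>-th power of the
radius of convergence of their generating functions, \<open>- \<alpha>\<close> and \<open>- 2 * \<alpha>\<close>.
Both sequences then have a finite nonzero limit.
\<close>

definition R_scaled :: "nat \<Rightarrow> real" where
  "R_scaled n = real (R n) * F_term (- \<alpha>) n"

text \<open>
A set of \<open>m \<ge> 1\<close> vertices has \<open>2 ^ (m - 1)\<close> even subsets but the
empty set has 1, not one half, so the empty digraph does not fit the convolution and
contributes to its right-hand side instead; hence the value 0 at 0.
\<close>

definition O_scaled :: "nat \<Rightarrow> real" where
  "O_scaled n = (if n = 0 then 0 else real (O_even n) * F_term (- 2 * \<alpha>) n)"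

lemma R_eq_card_dags: "R n = card (dags (\<lambda>_. True) {1..n})"
  using card_labelled_acyclic_digraphs[of n "\<lambda>_. True"] by (simp add: R_def)

lemma O_even_eq_card_dags: "O_even n = card (dags even {1..n})"
  using card_labelled_acyclic_digraphs[of n even] by (simp add: O_even_def)

text \<open>
With \<open>r(x)\<close> the generating function of \<open>R n / (n! * 2 ^ (n choose 2))\<close>, this is
\<open>F(- x) r(x) = 1\<close> with \<open>x\<close> rescaled by \<open>- \<alpha>\<close>.
\<close>

lemma F_term_convolution_R:
  "(\<Sum>k\<le>n. F_term \<alpha> k * R_scaled (n - k)) = (if n = 0 then 1 else 0)"
proof (cases "n = 0")
  case True
  have "dags (\<lambda>_. True) {1..0 :: nat} = {{}}" by (auto simp: dags_def acyclic_def)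
  with True show ?thesis by (simp add: R_scaled_def R_eq_card_dags binomial_eq_0)
next
  case False
  have "F_term \<alpha> k * R_scaled (n - k) = F_term (- \<alpha>) n *
      ((- 1) ^ k * real (n choose k) * real (2 ^ (n - k)) ^ k * real (R (n - k)))"
    if "k \<le> n" for k
  proof -
    have "F_term (- \<alpha>) n * ((- 1) ^ k * real (n choose k) * real (2 ^ (n - k)) ^ k * real (R (n - k)))
        = ((- \<alpha>) ^ n * (- 1) ^ k) * real (R (n - k)) *
          (real (n choose k) * 2 ^ ((n - k) * k) / (fact n * 2 ^ (n choose 2)))"
      by (simp add: power_mult)
    also have "(- \<alpha>) ^ n * (- 1) ^ k = \<alpha> ^ k * (- \<alpha>) ^ (n - k)"
      using that power_add[of "- \<alpha>" k "n - k"] by (simp add: mult_ac flip: power_mult_distrib)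
    finally show ?thesis
      unfolding binomial_over_normalisation[OF that] by (simp add: R_scaled_def)
  qed
  then have "(\<Sum>k\<le>n. F_term \<alpha> k * R_scaled (n - k)) = F_term (- \<alpha>) n * (\<Sum>k\<le>n.
      (- 1) ^ k * real (n choose k) * real (2 ^ (n - k)) ^ k * real (R (n - k)))"
    unfolding sum_distrib_left by (intro sum.cong) auto
  also have "\<dots> = 0"
    unfolding R_eq_card_dags using False
    by (subst dags_recurrence) (auto simp: card_Pow[unfolded Pow_def])
  finally show ?thesis using False by simp
qed

text \<open>
With \<open>o(x)\<close> the generating function of \<open>O_even n / (n! * 2 ^ (n choose 2))\<close> without its
constant term, this is \<open>F(- x / 2) o(x) = 1 - F(- x)\<close> with \<open>x\<close> rescaled by \<open>- 2 * \<alpha>\<close>.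
The argument \<open>x / 2\<close> comes from the exponent \<open>m - 1\<close> in the number of even subsets: each of
the \<open>k\<close> sources contributes a further factor one half.
\<close>

lemma F_term_convolution_O:
  "(\<Sum>k\<le>n. F_term \<alpha> k * O_scaled (n - k)) = (if n = 0 then 0 else - F_term (2 * \<alpha>) n)"
proof (cases "n = 0")
  case False
  \<comment> \<open>The recurrence for even out-degrees; its last term, for \<open>k = n\<close>, belongs to the empty digraph
    and goes to the right-hand side.\<close>
  define s where "s k = (- 1) ^ k * real (n choose k) * real (2 ^ (n - k - 1)) ^ k * real (O_even (n - k))" for k
  have "F_term \<alpha> k * O_scaled (n - k) = F_term (- 2 * \<alpha>) n * s k" if k: "k < n" for k
  proof -
    obtain m where m: "n - k = Suc m" using k by (metis Suc_diff_Suc)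
    have "F_term \<alpha> k * O_scaled (n - k) = (\<alpha> ^ k * (- 2 * \<alpha>) ^ (n - k)) * real (O_even (n - k)) *
          (1 / (fact k * 2 ^ (k choose 2)) * (1 / (fact (n - k) * 2 ^ ((n - k) choose 2))))"
      using that by (simp add: O_scaled_def)
    also have "\<dots> = (\<alpha> ^ k * (- 2 * \<alpha>) ^ (n - k)) * real (O_even (n - k)) *
          (real (n choose k) * 2 ^ ((n - k) * k) / (fact n * 2 ^ (n choose 2)))"
      using that by (subst binomial_over_normalisation) auto
    also have "(2::real) ^ ((n - k) * k) = 2 ^ k * (2 ^ (n - k - 1)) ^ k"
      unfolding m by (simp add: power_add power_mult)
    also have "\<alpha> ^ k * (- 2 * \<alpha>) ^ (n - k) * real (O_even (n - k)) *
        (real (n choose k) * (2 ^ k * (2 ^ (n - k - 1)) ^ k) / (fact n * 2 ^ (n choose 2)))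
      = ((\<alpha> ^ k * 2 ^ k) * (- 2 * \<alpha>) ^ (n - k)) * real (O_even (n - k)) *
        (real (n choose k) * (2 ^ (n - k - 1)) ^ k / (fact n * 2 ^ (n choose 2)))"
      by simp
    also have "\<alpha> ^ k * 2 ^ k = (- 1) ^ k * (- 2 * \<alpha>) ^ k"
      unfolding power_mult_distrib[symmetric] by (simp add: mult.commute)
    also have "(- 1) ^ k * (- 2 * \<alpha>) ^ k * (- 2 * \<alpha>) ^ (n - k) = (- 1) ^ k * (- 2 * \<alpha>) ^ n"
      using that by (simp add: power_add[symmetric])
    finally show ?thesis by (simp add: s_def)
  qed
  then have "(\<Sum>k\<le>n. F_term \<alpha> k * O_scaled (n - k)) = F_term (- 2 * \<alpha>) n * (\<Sum>k<n. s k)"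
    unfolding lessThan_Suc_atMost[symmetric] sum.lessThan_Suc sum_distrib_left
    by (simp add: O_scaled_def)
  also have "(\<Sum>k<n. s k) = - s n"
  proof -
    have "(\<Sum>k\<le>n. s k) = 0"
      unfolding s_def O_even_eq_card_dags using False card_even_subsets
      by (intro dags_recurrence) auto
    then show ?thesis by (simp add: lessThan_Suc_atMost[symmetric])
  qed
  also have "s n = (- 1) ^ n"
  proof -
    have "dags even {1..0 :: nat} = {{}}" by (auto simp: dags_def acyclic_def)
    then show ?thesis by (simp add: s_def O_even_eq_card_dags)
  qed
  also have "F_term (- 2 * \<alpha>) n * - ((- 1) ^ n) = - F_term (2 * \<alpha>) n"
    by (cases "even n") (simp_all add: power_mult_distrib)
  finally show ?thesis using False by simp
qed (simp add: O_scaled_def)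

section \<open>Asymptotics of the two counts\<close>

lemma alpha_neg: "\<alpha> < 0"
  using alpha(2) unfolding abs_less_iff by auto

text \<open>
Both scaled counts are quotients by the same series, that of \<open>F\<close> at \<open>\<alpha>\<close>, which sums to 0.
\<close>

lemma F_term_quotient_limit:
  assumes e: "summable (\<lambda>n. \<bar>e n\<bar>)"
    and conv: "\<And>n. (\<Sum>k\<le>n. F_term \<alpha> k * v (n - k)) = e n"
  shows "\<alpha> * F (\<alpha> / 2) < 0" and "v \<longlonglongrightarrow> (\<Sum>n. e n) / - (\<alpha> * F (\<alpha> / 2))"
proof -
  have abs: "\<bar>F_term \<alpha> n\<bar> = F_term (- \<alpha>) n" for n
    unfolding abs_F_term using alpha_neg by (simp only: abs_of_neg)
  have eqs: "(\<Sum>j. F_term \<alpha> j) = 0" "(\<Sum>j. \<bar>F_term \<alpha> j\<bar>) = F (- \<alpha>)"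
    "(\<Sum>j. real j * F_term \<alpha> j) = \<alpha> * F (\<alpha> / 2)"
    "(\<Sum>j. real j * \<bar>F_term \<alpha> j\<bar>) = (- \<alpha>) * F ((- \<alpha>) / 2)"
    unfolding abs using sums_F[of \<alpha>] sums_F[of "- \<alpha>"] alpha(1)
      sums_index_times_F_term[of \<alpha>] sums_index_times_F_term[of "- \<alpha>"]
    by (simp_all only: sums_iff)
  have summ: "summable (\<lambda>j. real j * \<bar>F_term \<alpha> j\<bar>)"
    unfolding abs using sums_index_times_F_term by (rule sums_summable)
  have small: "(\<Sum>j. real j * \<bar>F_term \<alpha> j\<bar>) < (\<Sum>j. \<bar>F_term \<alpha> j\<bar>)"
    unfolding eqs by (rule F_minus_alpha)
  have one: "F_term \<alpha> 0 = 1" by (simp add: binomial_eq_0)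
  note lim = convolution_quotient_limit[OF summ one eqs(1) small e conv]
  show "\<alpha> * F (\<alpha> / 2) < 0" "v \<longlonglongrightarrow> (\<Sum>n. e n) / - (\<alpha> * F (\<alpha> / 2))"
    using lim unfolding eqs .
qed

lemma alpha_F_half_alpha_neg: "\<alpha> * F (\<alpha> / 2) < 0"
  and R_scaled_tendsto: "R_scaled \<longlonglongrightarrow> C"
proof -
  have e: "summable (\<lambda>n::nat. \<bar>if n = 0 then 1 else 0 :: real\<bar>)"
    by (rule summable_finite[of "{0}"]) auto
  have "(\<Sum>n::nat. if n = 0 then 1 else 0 :: real) = 1"
    using suminf_finite[of "{0 :: nat}" "\<lambda>n. if n = 0 then 1 else 0 :: real"] by simp
  with F_term_quotient_limit[OF e F_term_convolution_R]
  show "\<alpha> * F (\<alpha> / 2) < 0" "R_scaled \<longlonglongrightarrow> C"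
    by (simp_all add: C_def)
qed

lemma O_scaled_tendsto: "O_scaled \<longlonglongrightarrow> K"
proof -
  let ?e = "\<lambda>n. if n = 0 then 0 else - F_term (2 * \<alpha>) n"
  have "(\<lambda>n. F_term (2 * \<alpha>) (Suc n)) sums (F (2 * \<alpha>) - 1)"
    using sums_F[of "2 * \<alpha>"] by (subst sums_Suc_iff) (simp add: binomial_eq_0)
  then have "(\<lambda>n. ?e (Suc n)) sums (1 - F (2 * \<alpha>))"
    using sums_minus by fastforce
  then have sum: "(\<Sum>n. ?e n) = 1 - F (2 * \<alpha>)"
    using sums_Suc[of ?e] by (auto simp: sums_iff)
  have e: "summable (\<lambda>n. \<bar>?e n\<bar>)"
  proof (rule summable_comparison_test'[OF summable_F[of "\<bar>2 * \<alpha>\<bar>"], of 0])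
    show "norm \<bar>?e n\<bar> \<le> F_term \<bar>2 * \<alpha>\<bar> n" for n
      unfolding abs_F_term[symmetric] by simp
  qed
  show ?thesis
    using F_term_quotient_limit(2)[OF e F_term_convolution_O] unfolding sum
    by (simp add: K_def)
qed

theorem corollary3p3:
  shows "(\<lambda>n. real (O_even n) / real (R n)) \<sim>[at_top] (\<lambda>n. K / (C * 2 ^ n))
    \<and> \<bar>K / C - 1.262\<bar> < 0.0005"
proof
  have C: "C \<noteq> 0" using alpha_F_half_alpha_neg by (auto simp: C_def)
  have KC: "K / C = 1 - F (2 * \<alpha>)"
    using alpha_F_half_alpha_neg by (auto simp: K_def C_def)
  show approx: "\<bar>K / C - 1.262\<bar> < 0.0005"
    unfolding KC by (rule F_twice_alpha)
  then have K: "K \<noteq> 0" by auto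
  have "(\<lambda>n. O_scaled n / R_scaled n / (K / C)) \<longlonglongrightarrow> K / C / (K / C)"
    using C K by (intro tendsto_intros O_scaled_tendsto R_scaled_tendsto) auto
  then have lim: "(\<lambda>n. O_scaled n / R_scaled n / (K / C)) \<longlonglongrightarrow> 1"
    using C K by simp
  have "O_scaled n / R_scaled n / (K / C) = real (O_even n) / real (R n) / (K / (C * 2 ^ n))"
    if "n > 0" for n
  proof -
    have "F_term (- 2 * \<alpha>) n = 2 ^ n * F_term (- \<alpha>) n"
      by (simp flip: power_mult_distrib)
    moreover have "F_term (- \<alpha>) n \<noteq> 0" using alpha_neg by simp
    ultimately have "O_scaled n / R_scaled n = 2 ^ n * (real (O_even n) / real (R n))"
      using that by (simp add: O_scaled_def R_scaled_def del: power_eq_0_iff)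
    then show ?thesis by simp
  qed
  then have "\<forall>\<^sub>F n in sequentially.
      O_scaled n / R_scaled n / (K / C) = real (O_even n) / real (R n) / (K / (C * 2 ^ n))"
    by (intro eventually_mono[OF eventually_gt_at_top[of 0]])
  with lim have "(\<lambda>n. real (O_even n) / real (R n) / (K / (C * 2 ^ n))) \<longlonglongrightarrow> 1"
    by (rule Lim_transform_eventually)
  then show "(\<lambda>n. real (O_even n) / real (R n)) \<sim>[at_top] (\<lambda>n. K / (C * 2 ^ n))"
    by (rule asymp_equivI')
qed

end
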